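(* Any randomised algorithm for the streaming parameterized matching problem requires $\Omega(|\Sigma|)$ bits of space, where $\Sigma$ is the pattern alphabet.
   Context: Two strings $S,S'$ of equal length $m$ parameterize match (p-match) if there is an injective function $f$ with $S'[j]=f(S[j])$ for all $j\in\{0,\dots,m-1\}$. In the streaming parameterized matching problem a pattern $P$ of length $m$ over alphabet $\Sigma$ is known in advance and the text $T$ arrives one symbol at a time; after $T[i]$ arrives and before $T[i+1]$ arrives, the algorithm must output whether $P$ p-matches $T[(i-m+1)..i]$. *)

theory Defs
  imports "HOL-Probability.Probability"
begin

definition p_match :: "'p list \<Rightarrow> 'a list \<Rightarrow> bool" where
  "p_match S S' \<longleftrightarrow> length S = length S' \<and>
     (\<exists>f. inj_on f (set S) \<and> (\<forall>j < length S. S' ! j = f (S ! j)))"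

text \<open>
  A randomised streaming algorithm, as it stands after the pattern has been preprocessed.
  Between two arrivals the only thing it keeps is its memory, a bit string. On an arriving
  symbol it tosses fresh coins, replaces its memory and emits one output bit. No computability
  or running-time restriction is imposed, and scratch space used while a symbol is being
  processed is not counted, so lower bounds in this model apply to any concrete machine model.
\<close>

record 'a stream_alg =
  init :: "bool list pmf"
  step :: "bool list \<Rightarrow> 'a \<Rightarrow> (bool list \<times> bool) pmf"

text \<open>
  Joint distribution of the memory and the most recent output bit after the text \<open>T\<close> has been
  read. The output component for the empty text is a dummy.
\<close>

definition run :: "'a stream_alg \<Rightarrow> 'a list \<Rightarrow> (bool list \<times> bool) pmf" where
  "run A T = foldl (\<lambda>D a. bind_pmf D (\<lambda>(w, _). step A w a))
               (map_pmf (\<lambda>w. (w, False)) (init A)) T"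

text \<open>\<open>\<Gamma>\<close> is the alphabet of the text.\<close>

definition uses_space :: "'a stream_alg \<Rightarrow> 'a set \<Rightarrow> nat \<Rightarrow> bool" where
  "uses_space A \<Gamma> s \<longleftrightarrow> (\<forall>T \<in> lists \<Gamma>. \<forall>(w, b) \<in> set_pmf (run A T). length w \<le> s)"

text \<open>
  For every fixed text, each single output is wrong with probability at most \<open>\<delta>\<close>. Outputs
  given before a full window of \<open>length P\<close> symbols has arrived are unconstrained.
\<close>

definition solves_pm :: "real \<Rightarrow> 'p list \<Rightarrow> 'a set \<Rightarrow> 'a stream_alg \<Rightarrow> bool" where
  "solves_pm \<delta> P \<Gamma> A \<longleftrightarrow>
     (\<forall>T \<in> lists \<Gamma>. length P \<le> length T \<longrightarrow>
        measure_pmf.prob (run A T)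
          {(w, b). b \<longleftrightarrow> p_match P (drop (length T - length P) T)} \<ge> 1 - \<delta>)"

end

theory Submission
  imports Defs
begin

text \<open>
  The memory of the algorithm serves as a one-way message in the augmented index problem, in which
  the receiver has to find one bit of a string from a message and all later bits. A bit string \<open>x\<close>
  of length about \<open>card \<Sigma> / 2\<close> becomes a text that contains, for each position, one of two symbols
  reserved for it. Knowing the later bits, one can continue the text such that a window starting at
  a given position matches a pattern with essentially distinct symbols iff the bit there is true.

  For the augmented index bound, every memory state \<open>w\<close> defines a probability distribution \<open>Q w\<close>
  on bit strings of length \<open>n\<close>, by predicting bit after bit from the end with the (damped)
  predictions of the receiver. Advantage over guessing makes the expectation of
  \<open>ln (2 ^ n * Q w x)\<close> at least linear in \<open>n\<close>, while the sum of \<open>Q w x\<close> over all \<open>x\<close> and \<open>w\<close> is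
  only the number of states.
\<close>

section \<open>The augmented index problem\<close>

context
  fixes G :: "'s \<Rightarrow> bool list \<Rightarrow> bool pmf" and d :: real
begin

text \<open>This is \<open>2 ^ n * Q w x\<close>. Each factor is twice the probability of
  \<open>b\<close> under a mixture of the receiver's prediction, with weight \<open>d / 2\<close>,
  and a fair coin.\<close>

fun likelihood_ratio :: "'s \<Rightarrow> bool list \<Rightarrow> real" where
  "likelihood_ratio w [] = 1"
| "likelihood_ratio w (b # xs) = (1 + d * (pmf (G w xs) b - 1 / 2)) * likelihood_ratio w xs"

lemma damped_prediction_bounds:
  assumes "0 \<le> d" "d \<le> 1"
  shows "\<bar>d * (pmf (G w xs) b - 1 / 2)\<bar> \<le> d / 2" "1 + d * (pmf (G w xs) b - 1 / 2) > 0"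
proof -
  have "\<bar>pmf (G w xs) b - 1 / 2\<bar> \<le> 1 / 2"
    using pmf_le_1[of "G w xs" b] pmf_nonneg[of "G w xs" b] by linarith
  from mult_left_mono[OF this assms(1)]
  show *: "\<bar>d * (pmf (G w xs) b - 1 / 2)\<bar> \<le> d / 2"
    using assms by (simp add: abs_mult)
  show "1 + d * (pmf (G w xs) b - 1 / 2) > 0"
    using * assms by linarith
qed

lemma likelihood_ratio_pos:
  assumes "0 \<le> d" "d \<le> 1"
  shows "likelihood_ratio w xs > 0"
  using damped_prediction_bounds(2)[OF assms] by (induction xs) auto

lemma sum_lists_length_Suc:
  fixes h :: "bool list \<Rightarrow> real"
  shows "(\<Sum>xs | length xs = Suc n. h xs) = (\<Sum>xs | length xs = n. h (True # xs) + h (False # xs))"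
proof -
  have "{xs :: bool list. length xs = Suc n} = (#) True ` {xs. length xs = n} \<union> (#) False ` {xs. length xs = n}"
    by (auto simp: length_Suc_conv image_iff)
  moreover have "finite {xs :: bool list. length xs = n}"
    using finite_lists_length_eq[of "UNIV :: bool set" n] by simp
  ultimately show ?thesis
    by (simp, subst sum.union_disjoint) (auto simp: sum.reindex sum.distrib)
qed

text \<open>The factors for the two values of a bit add up to 2, so \<open>Q w\<close> is a
  probability distribution.\<close>

lemma sum_likelihood_ratio:
  "(\<Sum>xs | length xs = n. likelihood_ratio w xs) = 2 ^ n"
proof (induction n)
  case (Suc n)
  have "pmf (G w xs) True + pmf (G w xs) False = 1" for xs
    using sum_pmf_eq_1[of "UNIV :: bool set" "G w xs"] by (simp add: UNIV_bool[symmetric]) (simp add: UNIV_bool)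
  then have F: "pmf (G w xs) False = 1 - pmf (G w xs) True" for xs
    by (simp add: eq_diff_eq' add.commute)
  have "likelihood_ratio w (True # xs) + likelihood_ratio w (False # xs) = 2 * likelihood_ratio w xs" for xs
    unfolding likelihood_ratio.simps F by (simp add: algebra_simps)
  then show ?case
    unfolding sum_lists_length_Suc using Suc by (simp add: sum_distrib_left[symmetric])
qed simp

text \<open>The logarithm is additive over positions. By the advantage \<open>d\<close>, the linear
  part of each term has expectation at least \<open>d * d\<close>; the damping keeps the quadratic
  loss below half of that.\<close>

lemma expectation_ln_likelihood_ratio:
  fixes D :: "'s pmf"
  assumes d: "0 \<le> d" "d \<le> 1" and fin: "finite (set_pmf D)"
    and G: "\<And>ys b zs. xs = ys @ b # zs \<Longrightarrow> pmf (bind_pmf D (\<lambda>w. G w zs)) b \<ge> 1 / 2 + d"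
  shows "length xs * (d\<^sup>2 / 2) \<le> measure_pmf.expectation D (\<lambda>w. ln (likelihood_ratio w xs))"
  using G
proof (induction xs)
  case (Cons b xs)
  note int [simp] = integrable_measure_pmf_finite[OF fin]
  let ?z = "\<lambda>w. d * (pmf (G w xs) b - 1 / 2)"
  have IH: "length xs * (d\<^sup>2 / 2) \<le> measure_pmf.expectation D (\<lambda>w. ln (likelihood_ratio w xs))"
    using Cons.prems by (intro Cons.IH) (metis append_Cons)
  have "1 / 2 + d \<le> measure_pmf.expectation D (\<lambda>w. pmf (G w xs) b)"
    using Cons.prems[of "[]" b xs] by (simp add: pmf_bind)
  then have "d * d \<le> d * (measure_pmf.expectation D (\<lambda>w. pmf (G w xs) b) - 1 / 2)"
    using d by (intro mult_left_mono) auto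
  then have "d\<^sup>2 / 2 \<le> d * (measure_pmf.expectation D (\<lambda>w. pmf (G w xs) b) - 1 / 2) - d\<^sup>2 / 2"
    by (simp add: power2_eq_square)
  also have "\<dots> = measure_pmf.expectation D (\<lambda>w. ?z w - d\<^sup>2 / 2)"
    by simp
  also have "\<dots> \<le> measure_pmf.expectation D (\<lambda>w. ln (1 + ?z w))"
  proof (intro integral_mono int)
    fix w
    note z = damped_prediction_bounds(1)[OF d, of w xs b]
    have "(?z w)\<^sup>2 \<le> (d / 2)\<^sup>2"
      using z by (intro abs_le_square_iff[THEN iffD1]) auto
    \<comment> \<open>Here \<open>\<bar>?z w\<bar> \<le> 1 / 2\<close>, and the error is at most
      \<open>2 * (d / 2)\<^sup>2 = d\<^sup>2 / 2\<close>.\<close>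
    moreover have "\<bar>ln (1 + ?z w) - ?z w\<bar> \<le> 2 * (?z w)\<^sup>2"
      using z d by (intro abs_ln_one_plus_x_minus_x_bound) linarith
    ultimately show "?z w - d\<^sup>2 / 2 \<le> ln (1 + ?z w)"
      by (simp add: power_divide)
  qed
  finally have "d\<^sup>2 / 2 \<le> measure_pmf.expectation D (\<lambda>w. ln (1 + ?z w))" .
  moreover have "ln (likelihood_ratio w (b # xs)) = ln (1 + ?z w) + ln (likelihood_ratio w xs)" for w
    using damped_prediction_bounds(2)[OF d] likelihood_ratio_pos[OF d] by (simp add: ln_mult_pos)
  ultimately show ?case
    using IH by (simp add: algebra_simps del: likelihood_ratio.simps)
qed simp

end

text \<open>Jensen's inequality for \<open>exp\<close>, obtained from the tangent at the
  mean.\<close>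

lemma exp_expectation_le:
  fixes h :: "'s \<Rightarrow> real"
  assumes "finite (set_pmf D)"
  shows "exp (measure_pmf.expectation D h) \<le> measure_pmf.expectation D (\<lambda>w. exp (h w))"
proof -
  note int [simp] = integrable_measure_pmf_finite[OF assms]
  define \<mu> where "\<mu> = measure_pmf.expectation D h"
  have "exp \<mu> = measure_pmf.expectation D (\<lambda>w. exp \<mu> * (1 + (h w - \<mu>)))"
    by (simp add: \<mu>_def)
  also have "\<dots> \<le> measure_pmf.expectation D (\<lambda>w. exp (h w))"
  proof (intro integral_mono int)
    fix w
    have "exp \<mu> * (1 + (h w - \<mu>)) \<le> exp \<mu> * exp (h w - \<mu>)"
      by (intro mult_left_mono exp_ge_add_one_self) auto
    then show "exp \<mu> * (1 + (h w - \<mu>)) \<le> exp (h w)"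
      by (simp flip: exp_add)
  qed
  finally show ?thesis
    by (simp add: \<mu>_def)
qed

text \<open>\<open>D\<close> is the sender and \<open>G\<close> the receiver. The sum of the
  likelihood ratios over all strings and all states in \<open>W\<close> is bounded below string by
  string and evaluated state by state.\<close>

theorem augmented_index_lower_bound:
  fixes D :: "bool list \<Rightarrow> 's pmf" and G :: "'s \<Rightarrow> bool list \<Rightarrow> bool pmf"
  assumes d: "0 \<le> d" "d \<le> 1" and "finite W"
    and D: "\<And>xs. length xs = n \<Longrightarrow> set_pmf (D xs) \<subseteq> W"
    and G: "\<And>ys b zs. length (ys @ b # zs) = n \<Longrightarrow>
              pmf (bind_pmf (D (ys @ b # zs)) (\<lambda>w. G w zs)) b \<ge> 1 / 2 + d"
  shows "exp (n * (d\<^sup>2 / 2)) \<le> card W"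
proof -
  let ?L = "likelihood_ratio G d"
  have pos: "?L w xs > 0" for w xs
    using likelihood_ratio_pos[OF d] .
  have *: "exp (n * (d\<^sup>2 / 2)) \<le> (\<Sum>w\<in>W. ?L w xs)" if xs: "length xs = n" for xs
  proof -
    have fin: "finite (set_pmf (D xs))"
      using D[OF xs] \<open>finite W\<close> finite_subset by blast
    have "exp (n * (d\<^sup>2 / 2)) \<le> exp (measure_pmf.expectation (D xs) (\<lambda>w. ln (?L w xs)))"
      using expectation_ln_likelihood_ratio[OF d fin, of xs G] G xs by auto
    also have "\<dots> \<le> measure_pmf.expectation (D xs) (\<lambda>w. exp (ln (?L w xs)))"
      by (rule exp_expectation_le[OF fin])
    also have "\<dots> = (\<Sum>w\<in>W. pmf (D xs) w * ?L w xs)"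
      using pos D[OF xs] \<open>finite W\<close> by (subst integral_measure_pmf[of W]) auto
    \<comment> \<open>Dropping the weights removes \<open>D xs\<close>, so the sums over states and
      strings can be exchanged later.\<close>
    also have "\<dots> \<le> (\<Sum>w\<in>W. ?L w xs)"
      using pos by (intro sum_mono mult_left_le_one_le) (auto intro: less_imp_le pmf_le_1)
    finally show ?thesis .
  qed
  have "card {xs :: bool list. length xs = n} = 2 ^ n"
    using card_lists_length_eq[of "UNIV :: bool set" n] by simp
  then have "2 ^ n * exp (n * (d\<^sup>2 / 2)) = (\<Sum>xs :: bool list | length xs = n. exp (n * (d\<^sup>2 / 2)))"
    by simp
  also have "\<dots> \<le> (\<Sum>xs | length xs = n. \<Sum>w\<in>W. ?L w xs)"
    using * by (intro sum_mono) auto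
  also have "\<dots> = (\<Sum>w\<in>W. \<Sum>xs | length xs = n. ?L w xs)"
    by (rule sum.swap)
  also have "\<dots> = 2 ^ n * card W"
    by (simp add: sum_likelihood_ratio)
  finally show ?thesis
    by simp
qed

section \<open>Streaming algorithms\<close>

definition run_from :: "'a stream_alg \<Rightarrow> bool list \<times> bool \<Rightarrow> 'a list \<Rightarrow> (bool list \<times> bool) pmf" where
  "run_from A w T = foldl (\<lambda>D a. bind_pmf D (\<lambda>(w, _). step A w a)) (return_pmf w) T"

lemma foldl_bind_pmf:
  "foldl (\<lambda>D a. bind_pmf D (f a)) D T =
     bind_pmf D (\<lambda>w. foldl (\<lambda>D a. bind_pmf D (f a)) (return_pmf w) T)"
proof (induction T rule: rev_induct)
  case Nil
  then show ?case
    by (simp add: bind_return_pmf')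
next
  case (snoc a T)
  then show ?case
    by (simp add: bind_assoc_pmf)
qed

text \<open>The process is Markov: the past acts on the future only through the state, which can
  therefore serve as the message.\<close>

lemma run_append: "run A (T @ U) = bind_pmf (run A T) (\<lambda>w. run_from A w U)"
  unfolding run_def run_from_def foldl_append by (rule foldl_bind_pmf)

lemma card_bool_lists_length_le:
  "finite {w :: bool list. length w \<le> s}" "card {w :: bool list. length w \<le> s} \<le> 2 ^ Suc s"
proof -
  show "finite {w :: bool list. length w \<le> s}"
    using finite_lists_length_le[of "UNIV :: bool set" s] by simp
  have "card {w :: bool list. length w \<le> s} = (\<Sum>i\<le>s. 2 ^ i)"
    using card_lists_length_le[of "UNIV :: bool set" s] by simp
  also have "\<dots> \<le> 2 ^ Suc s"
    by (induction s) auto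
  finally show "card {w :: bool list. length w \<le> s} \<le> 2 ^ Suc s" .
qed

section \<open>Encoding bit strings as texts\<close>

lemma p_match_iff_map: "p_match S S' \<longleftrightarrow> (\<exists>f. inj_on f (set S) \<and> S' = map f S)"
  unfolding p_match_def by (auto simp: list_eq_iff_nth_eq)

text \<open>As \<open>ps\<close> is distinct, \<open>ws\<close> is always some
  \<open>map f ps\<close>, and \<open>f\<close> is injective iff \<open>ws\<close> is distinct. The
  padding only repeats the last constraint; it allows patterns longer than the alphabet.\<close>

lemma p_match_distinct_replicate_last:
  assumes "distinct ps" "length ps = length ws" "ps \<noteq> []"
  shows "p_match (ps @ replicate r (last ps)) (ws @ replicate r (last ws)) \<longleftrightarrow> distinct ws"
proof
  assume "p_match (ps @ replicate r (last ps)) (ws @ replicate r (last ws))"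
  then obtain f where f: "inj_on f (set ps)" "ws = map f ps"
    using assms unfolding p_match_iff_map by (auto simp: inj_on_Un)
  then show "distinct ws"
    using assms by (simp add: distinct_map)
next
  assume "distinct ws"
  define f where "f = the \<circ> map_of (zip ps ws)"
  have f: "ws = map f ps"
  proof (rule nth_equalityI)
    fix i assume "i < length ws"
    then show "ws ! i = map f ps ! i"
      using assms(1,2) by (simp add: f_def map_of_zip_nth)
  qed (use assms(2) in simp)
  moreover have "set (ps @ replicate r (last ps)) = set ps"
    using assms by auto
  moreover have "inj_on f (set ps)"
    using \<open>distinct ws\<close> f by (simp add: distinct_map)
  moreover have "last ws = f (last ps)"
    using f assms by (simp add: last_map)
  ultimately show "p_match (ps @ replicate r (last ps)) (ws @ replicate r (last ws))"
    unfolding p_match_iff_map by (intro exI[of _ f]) simp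
qed

text \<open>The symbols \<open>e (2 * j)\<close> and \<open>e (2 * j + 1)\<close> are reserved for the bit that has \<open>j\<close> successors.\<close>

fun enc :: "(nat \<Rightarrow> 'a) \<Rightarrow> bool list \<Rightarrow> 'a list" where
  "enc e [] = []"
| "enc e (b # xs) = e (2 * length xs + (if b then 0 else 1)) # enc e xs"

lemma length_enc [simp]: "length (enc e xs) = length xs"
  by (induction xs) auto

text \<open>Symbols are indexed by distance from the end, so a receiver who knows the later bits
  knows their encoding.\<close>

lemma enc_append: "\<exists>us. length us = length ys \<and> enc e (ys @ xs) = us @ enc e xs"
proof (induction ys)
  case (Cons b ys)
  then obtain us where "length us = length ys" "enc e (ys @ xs) = us @ enc e xs"
    by auto
  then show ?case
    by (intro exI[of _ "e (2 * length (ys @ xs) + (if b then 0 else 1)) # us"]) auto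
qed auto

lemma set_enc_subset: "set (enc e xs) \<subseteq> e ` {..<2 * length xs}"
  by (induction xs) (auto intro!: imageI)

lemma distinct_enc: "inj_on e {..<2 * length xs} \<Longrightarrow> distinct (enc e xs)"
proof (induction xs)
  case (Cons b xs)
  have "e (2 * length xs + (if b then 0 else 1)) \<notin> e ` {..<2 * length xs}"
    using Cons.prems by (subst inj_on_image_mem_iff[where B = "{..<2 * length (b # xs)}"]) auto
  moreover have "inj_on e {..<2 * length xs}"
    using Cons.prems by (rule inj_on_subset) auto
  ultimately show ?case
    using Cons.IH set_enc_subset[of e xs] by auto
qed simp

text \<open>The sender runs \<open>A\<close> on \<open>enc e x\<close>; the receiver resumes from
  the state and takes the final output as the guess.\<close>

lemma streaming_lower_bound:
  fixes e :: "nat \<Rightarrow> 'a" and ps :: "'p list"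
  assumes \<delta>: "0 \<le> \<delta>" "\<delta> < 1 / 2"
    and ps: "distinct ps" "length ps = k" "2 \<le> k"
    and e: "inj_on e {..<k}" "e ` {..<k} \<subseteq> \<Gamma>"
    and solves: "solves_pm \<delta> (ps @ replicate r (last ps)) \<Gamma> A"
    and space: "uses_space A \<Gamma> s"
  shows "real (k div 2) * ((1 / 2 - \<delta>)\<^sup>2 / 2) \<le> real s + 2"
proof -
  define n where "n = k div 2"
  define P where "P = ps @ replicate r (last ps)"
  define rest where "rest zs = (SOME vs. distinct vs \<and>
    set vs = e ` {..<k} - set (enc e zs) - {e (2 * length zs)})" for zs
  \<comment> \<open>A state of \<open>run\<close> also carries the latest output bit, which doubles
    the count.\<close>
  define W where "W = {w :: bool list. length w \<le> s} \<times> (UNIV :: bool set)"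
  define G where "G w zs = map_pmf snd (run_from A w (rest zs @ replicate r (last (rest zs))))" for w zs
  have enc_in: "set (enc e xs) \<subseteq> \<Gamma>" if "length xs \<le> n" for xs
    using set_enc_subset[of e xs] that e unfolding n_def by fastforce
  have "exp (n * ((1 / 2 - \<delta>)\<^sup>2 / 2)) \<le> card W"
  proof (rule augmented_index_lower_bound)
    show "finite W"
      unfolding W_def using card_bool_lists_length_le(1) by simp
    show "set_pmf (run A (enc e xs)) \<subseteq> W" if "length xs = n" for xs
      using space enc_in[of xs] that unfolding uses_space_def W_def by fastforce
    fix ys zs :: "bool list" and b
    assume len: "length (ys @ b # zs) = n"
    let ?a = "e (2 * length zs)" and ?u = "enc e zs"
    have lt: "2 * length zs + 1 < k"
      using len by (auto simp: n_def)
    have inj: "inj_on e {..<2 * length (b # zs)}"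
      using e(1) by (rule inj_on_subset) (use lt in auto)
    have du: "distinct (?a # ?u)"
      using distinct_enc[of e "True # zs"] inj by simp
    have su: "set (?a # ?u) \<subseteq> e ` {..<k}"
      using set_enc_subset[of e "True # zs"] lt by force
    have "\<exists>vs. distinct vs \<and> set vs = e ` {..<k} - set ?u - {?a}"
      using finite_distinct_list[of "e ` {..<k} - set ?u - {?a}"] by auto
    then have v: "distinct (rest zs)" "set (rest zs) = e ` {..<k} - set ?u - {?a}"
      unfolding rest_def by (metis (mono_tags, lifting) someI_ex)+
    have "length (rest zs) = card (e ` {..<k} - set (?a # ?u))"
      using distinct_card[OF v(1)] v(2) by (simp add: Diff_insert2[symmetric] Diff_insert[symmetric])
    also have "\<dots> = k - card (set (?a # ?u))"
      using su e(1) by (subst card_Diff_subset) (auto simp: card_image)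
    also have "\<dots> = k - Suc (length zs)"
      using distinct_card[OF du] by simp
    finally have lv: "length (rest zs) = k - Suc (length zs)" .
    define c where "c = e (2 * length zs + (if b then 0 else 1))"
    define ws where "ws = c # ?u @ rest zs"
    have lws: "length ws = k"
      using lv lt by (simp add: ws_def)
    \<comment> \<open>Hence the symbol repeated in the padding is known to the receiver.\<close>
    have "rest zs \<noteq> []"
      using lv lt by auto
    then have lastws: "last ws = last (rest zs)"
      by (simp add: ws_def)
    have dws: "distinct ws \<longleftrightarrow> b"
    proof
      assume b: b
      then show "distinct ws"
        using du v by (auto simp: ws_def c_def)
    next
      assume dist: "distinct ws"
      show b
      proof (rule ccontr)
        assume "\<not> b"
        then have "c = e (2 * length zs + 1)"
          by (simp add: c_def)
        moreover have "e (2 * length zs + 1) \<noteq> ?a"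
          using e(1) lt by (auto dest: inj_onD)
        moreover have "c \<in> e ` {..<k}"
          using lt by (auto simp: c_def)
        ultimately have "c \<in> set ?u \<union> set (rest zs)"
          using v by auto
        then show False
          using dist by (auto simp: ws_def)
      qed
    qed
    obtain us where us: "length us = length ys" "enc e (ys @ b # zs) = us @ c # ?u"
      using enc_append[of ys e "b # zs"] by (auto simp: c_def)
    let ?v = "rest zs @ replicate r (last (rest zs))"
    define T where "T = enc e (ys @ b # zs) @ ?v"
    have T: "T = us @ ws @ replicate r (last ws)"
      unfolding T_def us(2) using lastws by (simp add: ws_def)
    have lP: "length P = k + r"
      using ps by (simp add: P_def)
    have "drop (length T - length P) T = ws @ replicate r (last ws)"
      unfolding T using lP lws by simp
    moreover have "p_match P (ws @ replicate r (last ws)) \<longleftrightarrow> distinct ws"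
      unfolding P_def using ps lws by (intro p_match_distinct_replicate_last) auto
    ultimately have match: "p_match P (drop (length T - length P) T) \<longleftrightarrow> b"
      using dws by simp
    have "set ?v \<subseteq> \<Gamma>"
      using v e(2) \<open>rest zs \<noteq> []\<close> last_in_set[of "rest zs"] by auto
    then have "T \<in> lists \<Gamma>"
      using enc_in[of "ys @ b # zs"] len by (auto simp: T_def)
    moreover have "length P \<le> length T"
      using lP lws by (simp add: T)
    ultimately have "1 - \<delta> \<le> measure_pmf.prob (run A T) {(w, b'). b' \<longleftrightarrow> p_match P (drop (length T - length P) T)}"
      using solves unfolding solves_pm_def P_def by blast
    also have "{(w, b'). b' \<longleftrightarrow> p_match P (drop (length T - length P) T)} = snd -` {b}"
      unfolding match by (rule set_eqI) (simp add: split_beta)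
    also have "measure_pmf.prob (run A T) (snd -` {b}) = pmf (map_pmf snd (run A T)) b"
      by (simp add: pmf_map)
    also have "map_pmf snd (run A T) = bind_pmf (run A (enc e (ys @ b # zs))) (\<lambda>w. G w zs)"
      unfolding T_def run_append G_def by (simp add: map_bind_pmf)
    finally show "1 / 2 + (1 / 2 - \<delta>) \<le> pmf (bind_pmf (run A (enc e (ys @ b # zs))) (\<lambda>w. G w zs)) b"
      by simp
  qed (use \<delta> in auto)
  also have "real (card W) \<le> 2 ^ (s + 2)"
    using card_bool_lists_length_le(2)[of s] unfolding W_def card_cartesian_product
    by (simp add: UNIV_bool of_nat_le_iff[where ?'a = real, symmetric] del: of_nat_le_iff)
  \<comment> \<open>Since 2 is at most \<open>exp 1\<close>, the exponents can be compared
    directly.\<close>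
  also have "\<dots> \<le> exp 1 ^ (s + 2)"
    using exp_ge_add_one_self[of 1] by (intro power_mono) auto
  also have "\<dots> = exp (real s + 2)"
    by (metis exp_of_nat_mult mult.right_neutral of_nat_add of_nat_numeral)
  finally show ?thesis
    by (simp add: n_def)
qed

theorem theorem2:
  fixes \<delta> :: real
  assumes "0 \<le> \<delta>" and "\<delta> < 1 / 2"
  shows "\<exists>c > 0. \<exists>k\<^sub>0 :: nat. \<forall>(\<Sigma> :: 'p set) (\<Gamma> :: 'a set) (m :: nat).
           finite \<Sigma> \<and> k\<^sub>0 \<le> card \<Sigma> \<and> card \<Sigma> \<le> m \<and> finite \<Gamma> \<and> card \<Sigma> \<le> card \<Gamma> \<longrightarrow>
           (\<exists>P. length P = m \<and> set P = \<Sigma> \<and>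
              (\<forall>A s. solves_pm \<delta> P \<Gamma> A \<and> uses_space A \<Gamma> s \<longrightarrow>
                 c * real (card \<Sigma>) \<le> real s))"
proof -
  define \<gamma> where "\<gamma> = (1 / 2 - \<delta>)\<^sup>2 / 2"
  \<comment> \<open>From here on, \<open>\<gamma> * k / 4\<close> absorbs both the additive 2 and
    the rounding in \<open>k div 2 \<ge> (k - 1) / 2\<close>.\<close>
  define k\<^sub>0 where "k\<^sub>0 = nat \<lceil>2 + 8 / \<gamma>\<rceil>"
  have \<gamma>: "\<gamma> > 0"
    using assms by (simp add: \<gamma>_def)
  have "\<exists>P. length P = m \<and> set P = \<Sigma> \<and>
          (\<forall>A s. solves_pm \<delta> P \<Gamma> A \<and> uses_space A \<Gamma> s \<longrightarrow> \<gamma> / 4 * real (card \<Sigma>) \<le> real s)"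
    if *: "finite \<Sigma>" "k\<^sub>0 \<le> card \<Sigma>" "card \<Sigma> \<le> m" "finite \<Gamma>" "card \<Sigma> \<le> card \<Gamma>"
    for \<Sigma> :: "'p set" and \<Gamma> :: "'a set" and m
  proof -
    define k where "k = card \<Sigma>"
    have k: "2 + 8 / \<gamma> \<le> real k"
      using *(2) unfolding k\<^sub>0_def k_def by linarith
    have "0 < 8 / \<gamma>"
      using \<gamma> by simp
    then have k2: "2 \<le> k"
      using k by linarith
    obtain ps where ps: "set ps = \<Sigma>" "distinct ps"
      using finite_distinct_list[OF *(1)] by auto
    then have lps: "length ps = k"
      by (metis distinct_card k_def)
    obtain e where e: "bij_betw e {..<card \<Gamma>} \<Gamma>"
      using ex_bij_betw_nat_finite[OF *(4)] by (auto simp: atLeast0LessThan)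
    \<comment> \<open>The text uses only \<open>k\<close> symbols of \<open>\<Gamma>\<close>,
      available because \<open>card \<Sigma> \<le> card \<Gamma>\<close>.\<close>
    have e1: "inj_on e {..<k}" "e ` {..<k} \<subseteq> \<Gamma>"
      using e *(5) by (auto simp: bij_betw_def k_def intro: inj_on_subset)
    let ?P = "ps @ replicate (m - k) (last ps)"
    have "ps \<noteq> []"
      using lps k2 by auto
    then have "set ?P = \<Sigma>"
      using ps by auto
    moreover have "length ?P = m"
      using lps *(3) by (simp add: k_def)
    moreover have "\<gamma> / 4 * real k \<le> real s" if "solves_pm \<delta> ?P \<Gamma> A" "uses_space A \<Gamma> s" for A s
    proof -
      have "(real k - 1) / 2 * \<gamma> \<le> real (k div 2) * \<gamma>"
      proof (rule mult_right_mono)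
        have "real k \<le> real (2 * (k div 2) + 1)"
          unfolding of_nat_le_iff by presburger
        then show "(real k - 1) / 2 \<le> real (k div 2)"
          by simp
      qed (use \<gamma> in simp)
      also have "\<dots> \<le> real s + 2"
        using streaming_lower_bound[OF assms ps(2) lps k2 e1 that] by (simp add: \<gamma>_def)
      finally have "(real k - 1) / 2 * \<gamma> \<le> real s + 2" .
      moreover have "2 * \<gamma> + 8 \<le> real k * \<gamma>"
        using mult_right_mono[OF k, of \<gamma>] \<gamma> by (simp add: distrib_right)
      ultimately show ?thesis
        by (simp add: field_simps)
    qed
    ultimately show ?thesis
      unfolding k_def by blast
  qed
  then show ?thesis
    using \<gamma> by (intro exI[of _ "\<gamma> / 4"] conjI exI[of _ k\<^sub>0] allI impI) auto
qed

end
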